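(* Let $R$ be a commutative Artinian local ring with unity. Then the upper ideal relation graph $\Gamma_U(R)$ is a line graph of some graph if and only if $R$ is a principal ideal ring.
   Context: For a commutative ring $R$ with unity, the upper ideal relation graph $\Gamma_U(R)$ is the simple undirected graph whose vertex set is the set of all non-unit elements of $R$, two distinct vertices $x,y$ being adjacent if and only if there is a non-unit element $z\in R$ such that the principal ideals $(x)$ and $(y)$ are both contained in the principal ideal $(z)$. The line graph $L(H)$ of a simple undirected graph $H$ has vertex set $E(H)$, and two distinct vertices of $L(H)$ are adjacent if and only if the corresponding edges share a common vertex in $H$. A graph is "a line graph of some graph" if it is isomorphic to $L(H)$ for some simple undirected graph $H$. A ring is local if it has exactly one maximal ideal. A principal ideal ring is a ring in which every ideal is principal. *)

theory Defs
  imports "HOL-Algebra.Algebra"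
begin

section \<open>Simple undirected graphs and line graphs\<close>

text \<open>Graphs may be infinite, since an Artinian local ring may have infinitely many non-units.\<close>

record 'v ugraph =
  verts :: "'v set"
  edges :: "'v set set"

definition simple_graph :: "'v ugraph \<Rightarrow> bool" where
  "simple_graph G \<longleftrightarrow> (\<forall>e \<in> edges G. e \<subseteq> verts G \<and> card e = 2)"

definition graph_iso :: "('v \<Rightarrow> 'w) \<Rightarrow> 'v ugraph \<Rightarrow> 'w ugraph \<Rightarrow> bool" where
  "graph_iso f G H \<longleftrightarrow> bij_betw f (verts G) (verts H) \<and>
     (\<forall>x \<in> verts G. \<forall>y \<in> verts G. {x, y} \<in> edges G \<longleftrightarrow> {f x, f y} \<in> edges H)"

definition isomorphic_graphs :: "'v ugraph \<Rightarrow> 'w ugraph \<Rightarrow> bool" where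
  "isomorphic_graphs G H \<longleftrightarrow> (\<exists>f. graph_iso f G H)"

definition line_graph :: "'v ugraph \<Rightarrow> 'v set ugraph" where
  "line_graph H = \<lparr>verts = edges H,
     edges = {{d, e} | d e. d \<in> edges H \<and> e \<in> edges H \<and> d \<noteq> e \<and> d \<inter> e \<noteq> {}}\<rparr>"

text \<open>
  HOL cannot quantify existentially over the type of vertices of \<open>H\<close>. The type \<^typ>\<open>'v \<times> bool\<close> is
  large enough: apart from isolated vertices, which do not affect the line graph, \<open>H\<close> has at
  most two vertices per edge, and its edges correspond to the vertices of \<open>G\<close>. Lemma
  \<open>is_line_graphI\<close> below shows that nothing is lost by this choice.
\<close>

definition is_line_graph :: "'v ugraph \<Rightarrow> bool" where
  "is_line_graph G \<longleftrightarrow>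
     (\<exists>H :: ('v \<times> bool) ugraph. simple_graph H \<and> isomorphic_graphs G (line_graph H))"

lemma simple_line_graph: "simple_graph (line_graph H)"
  by (fastforce simp: simple_graph_def line_graph_def card_2_iff)

lemma line_graph_edge_iff:
  "{d, e} \<in> edges (line_graph H) \<longleftrightarrow>
     d \<in> edges H \<and> e \<in> edges H \<and> d \<noteq> e \<and> d \<inter> e \<noteq> {}"
  by (auto simp: line_graph_def doubleton_eq_iff)

lemma is_line_graphI:
  fixes G :: "'v ugraph" and H :: "'w ugraph"
  assumes H: "simple_graph H" and iso: "isomorphic_graphs G (line_graph H)"
  shows "is_line_graph G"
proof -
  obtain f where bij: "bij_betw f (verts G) (edges H)"
    and adj: "\<And>x y. x \<in> verts G \<Longrightarrow> y \<in> verts G \<Longrightarrow>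
      {x, y} \<in> edges G \<longleftrightarrow> {f x, f y} \<in> edges (line_graph H)"
    using iso unfolding isomorphic_graphs_def graph_iso_def by (auto simp: line_graph_def)
  have card2: "card e = 2" if "e \<in> edges H" for e
    using H that by (auto simp: simple_graph_def)
  define W where "W = \<Union>(edges H)"
  define ed where "ed w = (SOME e. e \<in> edges H \<and> w \<in> e)" for w
  define p :: "'w set \<Rightarrow> 'w" where "p e = (SOME w. w \<in> e)" for e
  define g where "g w = (inv_into (verts G) f (ed w), w = p (ed w))" for w
  have ed: "ed w \<in> edges H" "w \<in> ed w" if "w \<in> W" for w
    using someI_ex[of "\<lambda>e. e \<in> edges H \<and> w \<in> e"] that unfolding ed_def W_def by blast+
  have p: "p e \<in> e" if "e \<in> edges H" for e
    using card2[OF that] unfolding p_def by (metis card.empty ex_in_conv someI_ex zero_neq_numeral)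
  have inj: "inj_on g W"
  proof (rule inj_onI)
    fix v w assume vw: "v \<in> W" "w \<in> W" "g v = g w"
    have "ed v = ed w"
      using vw ed(1) bij inj_on_eq_iff[OF inj_on_inv_into[of "edges H" f "verts G"]]
      unfolding g_def bij_betw_def by auto
    moreover have "v = p (ed v) \<longleftrightarrow> w = p (ed w)" using vw(3) by (simp add: g_def)
    ultimately show "v = w"
      using ed[OF vw(1)] ed(2)[OF vw(2)] p[OF ed(1)[OF vw(1)]] card2[OF ed(1)[OF vw(1)]]
      by (auto simp: card_2_iff)
  qed
  define H' where "H' = \<lparr>verts = g ` W, edges = (`) g ` edges H\<rparr>"
  have sub: "e \<subseteq> W" if "e \<in> edges H" for e
    using that by (auto simp: W_def)
  have "simple_graph H'"
    using card2 sub inj_on_subset[OF inj]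
    by (auto simp: simple_graph_def H'_def card_image)
  moreover have "graph_iso (\<lambda>x. g ` f x) G (line_graph H')"
    unfolding graph_iso_def
  proof (intro conjI ballI)
    have "inj_on ((`) g) (edges H)"
      using inj sub by (meson inj_onI inj_on_image_eq_iff)
    then have "bij_betw ((`) g) (edges H) (edges H')"
      by (simp add: H'_def bij_betw_def)
    from bij_betw_trans[OF bij this]
    show "bij_betw (\<lambda>x. g ` f x) (verts G) (verts (line_graph H'))"
      by (simp add: line_graph_def comp_def)
  next
    fix x y assume xy: "x \<in> verts G" "y \<in> verts G"
    have fxy: "f x \<in> edges H" "f y \<in> edges H"
      using xy bij by (auto simp: bij_betw_def)
    have "g ` f x \<inter> g ` f y = g ` (f x \<inter> f y)"
      using inj_on_image_Int[OF inj sub sub] fxy by simp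
    moreover have "g ` f x = g ` f y \<longleftrightarrow> f x = f y"
      using inj_on_image_eq_iff[OF inj sub sub] fxy by simp
    ultimately show "{x, y} \<in> edges G \<longleftrightarrow> {g ` f x, g ` f y} \<in> edges (line_graph H')"
      unfolding adj[OF xy] line_graph_edge_iff using fxy by (auto simp: H'_def)
  qed
  ultimately show ?thesis
    unfolding is_line_graph_def isomorphic_graphs_def by blast
qed


section \<open>Classes of rings\<close>

locale artinian_ring = ring +
  assumes descending_chain: "\<lbrakk>\<And>n :: nat. ideal (I n) R; antimono I\<rbrakk> \<Longrightarrow> \<exists>n. \<forall>m \<ge> n. I m = I n"

locale local_ring = ring +
  assumes unique_maximal: "\<exists>!M. maximalideal M R"

locale principal_ideal_ring = ring +
  assumes principal: "ideal I R \<Longrightarrow> principalideal I R"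

text \<open>Over a noncommutative ring the notions above would refer to two-sided ideals; they are
  only used in conjunction with \<^locale>\<open>cring\<close>.\<close>


section \<open>The upper ideal relation graph\<close>

definition nonunits :: "('a, 'b) ring_scheme \<Rightarrow> 'a set" where
  "nonunits R = carrier R - Units R"

definition upper_ideal_relation_graph :: "('a, 'b) ring_scheme \<Rightarrow> 'a ugraph" where
  "upper_ideal_relation_graph R = \<lparr>verts = nonunits R,
     edges = {{x, y} | x y. x \<in> nonunits R \<and> y \<in> nonunits R \<and> x \<noteq> y \<and>
       (\<exists>z \<in> nonunits R. PIdl\<^bsub>R\<^esub> x \<subseteq> PIdl\<^bsub>R\<^esub> z \<and> PIdl\<^bsub>R\<^esub> y \<subseteq> PIdl\<^bsub>R\<^esub> z)}\<rparr>"

lemma simple_upper_ideal_relation_graph: "simple_graph (upper_ideal_relation_graph R)"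
  by (fastforce simp: simple_graph_def upper_ideal_relation_graph_def card_2_iff)

end

theory Submission
  imports Defs
begin

text \<open>
  The non-units of \<open>R\<close> form the maximal ideal \<open>M\<close>. The descending chain condition makes \<open>M\<close>
  T-nilpotent (a product of sufficiently many terms of any sequence in \<open>M\<close> vanishes), so every
  non-unit lies in a maximal proper principal ideal, and if \<open>M = (m)\<close>, then every element of \<open>R\<close>
  is zero or a unit times a power of \<open>m\<close>, so that every ideal is generated by a power of \<open>m\<close>.
  Hence \<open>R\<close> is a principal ideal ring iff \<open>M\<close> is principal.

  If \<open>M\<close> is principal, the graph is complete, and so it is the line graph of a star. Otherwise take
  a maximal proper principal ideal \<open>(x)\<close> and a non-unit \<open>y\<close> outside \<open>(x)\<close> with \<open>(y)\<close> maximal as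
  well. Then \<open>x\<close>, \<open>y\<close>, \<open>x + y\<close> are pairwise non-adjacent but all adjacent to \<open>0\<close>, and this
  induced claw cannot occur in a line graph.
\<close>

section \<open>Claws and complete graphs as obstruction and source of line graphs\<close>

text \<open>Pigeonhole: the edge \<open>c\<close> has only two endpoints, so among three edges that
  meet \<open>c\<close>, two pass through the same endpoint.\<close>

lemma line_graph_claw_free:
  assumes "simple_graph H"
    and c: "{c, d\<^sub>1} \<in> edges (line_graph H)" "{c, d\<^sub>2} \<in> edges (line_graph H)"
      "{c, d\<^sub>3} \<in> edges (line_graph H)"
    and "d\<^sub>1 \<noteq> d\<^sub>2" "d\<^sub>1 \<noteq> d\<^sub>3" "d\<^sub>2 \<noteq> d\<^sub>3"
  shows "{d\<^sub>1, d\<^sub>2} \<in> edges (line_graph H) \<or> {d\<^sub>1, d\<^sub>3} \<in> edges (line_graph H) \<or>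
    {d\<^sub>2, d\<^sub>3} \<in> edges (line_graph H)"
proof -
  have "c \<in> edges H"
    using c(1) by (simp add: line_graph_edge_iff)
  then obtain u v where "c = {u, v}"
    using assms(1) by (auto simp: simple_graph_def card_2_iff)
  then show ?thesis
    using assms unfolding line_graph_edge_iff by blast
qed

lemma is_line_graph_claw_free:
  assumes "is_line_graph G" and "simple_graph G"
    and "{c, x} \<in> edges G" "{c, y} \<in> edges G" "{c, z} \<in> edges G"
    and "x \<noteq> y" "x \<noteq> z" "y \<noteq> z"
  shows "{x, y} \<in> edges G \<or> {x, z} \<in> edges G \<or> {y, z} \<in> edges G"
proof -
  obtain H :: "('a \<times> bool) ugraph" and f where H: "simple_graph H"
    and bij: "bij_betw f (verts G) (verts (line_graph H))"
    and adj: "\<And>x y. x \<in> verts G \<Longrightarrow> y \<in> verts G \<Longrightarrow>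
      {x, y} \<in> edges G \<longleftrightarrow> {f x, f y} \<in> edges (line_graph H)"
    using assms(1) unfolding is_line_graph_def isomorphic_graphs_def graph_iso_def by blast
  have V: "c \<in> verts G" "x \<in> verts G" "y \<in> verts G" "z \<in> verts G"
    using assms(2-5) by (auto simp: simple_graph_def)
  have "f x \<noteq> f y" "f x \<noteq> f z" "f y \<noteq> f z"
    using bij V assms(6-8) by (auto simp: bij_betw_def inj_on_eq_iff)
  then show ?thesis
    using line_graph_claw_free[OF H, of "f c" "f x" "f y" "f z"] assms(3-5) V by (simp add: adj)
qed

lemma complete_graph_is_line_graph:
  assumes "simple_graph G"
    and "\<And>x y. x \<in> verts G \<Longrightarrow> y \<in> verts G \<Longrightarrow> x \<noteq> y \<Longrightarrow> {x, y} \<in> edges G"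
  shows "is_line_graph G"
proof -
  \<comment> \<open>The star has centre \<open>None\<close>, and its spoke to the leaf
    \<open>Some x\<close> represents the vertex \<open>x\<close>. Any two spokes meet in the
    centre.\<close>
  define f where "f x = {None, Some x}" for x :: 'a
  define H where "H = \<lparr>verts = UNIV, edges = f ` verts G\<rparr>"
  have f_eq: "f x = f y \<longleftrightarrow> x = y" for x y
    by (auto simp: f_def doubleton_eq_iff)
  \<comment> \<open>\<open>graph_iso\<close> also compares a vertex with itself, so singletons must
    be excluded as edges.\<close>
  have loop: "{x} \<notin> edges G" for x
    using assms(1) by (auto simp: simple_graph_def)
  have "simple_graph H"
    by (auto simp: simple_graph_def H_def f_def)
  moreover have "graph_iso f G (line_graph H)"
    unfolding graph_iso_def
  proof (intro conjI ballI)
    show "bij_betw f (verts G) (verts (line_graph H))"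
      by (auto simp: bij_betw_def line_graph_def H_def f_eq intro: inj_onI)
  next
    fix x y assume xy: "x \<in> verts G" "y \<in> verts G"
    have "f x \<inter> f y \<noteq> {}"
      by (auto simp: f_def)
    then have "{f x, f y} \<in> edges (line_graph H) \<longleftrightarrow> x \<noteq> y"
      using xy unfolding line_graph_edge_iff by (auto simp: H_def f_eq)
    then show "{x, y} \<in> edges G \<longleftrightarrow> {f x, f y} \<in> edges (line_graph H)"
      using assms(2)[OF xy] loop by auto
  qed
  ultimately show ?thesis
    using is_line_graphI unfolding isomorphic_graphs_def by blast
qed

section \<open>Ideals, divisibility and non-units\<close>

text \<open>Zorn's lemma for the ideals above \<open>J\<close> that avoid the unit element: a union
  of a nonempty chain of them still avoids it.\<close>

lemma (in ring) proper_ideal_subset_maximalideal: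
  assumes "ideal J R" and "\<one> \<notin> J"
  obtains M where "maximalideal M R" "J \<subseteq> M"
proof -
  define A where "A = {I. ideal I R \<and> J \<subseteq> I \<and> \<one> \<notin> I}"
  have "\<exists>M\<in>A. \<forall>I\<in>A. M \<subseteq> I \<longrightarrow> I = M"
  proof (rule subset_Zorn_nonempty)
    show "A \<noteq> {}"
      using assms by (auto simp: A_def)
  next
    fix C assume C: "C \<noteq> {}" "subset.chain A C"
    then have CA: "C \<subseteq> A"
      by (auto simp: subset_chain_def)
    have "subset.chain {I. ideal I R} C"
      using C(2) by (auto simp: subset_chain_def A_def)
    from chain_Union_is_ideal[OF this] C(1) have "ideal (\<Union>C) R"
      by simp
    then show "\<Union>C \<in> A"
      using C(1) CA by (auto simp: A_def)
  qed
  then obtain M where M: "M \<in> A" "\<And>I. I \<in> A \<Longrightarrow> M \<subseteq> I \<Longrightarrow> I = M"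
    by blast
  have "maximalideal M R"
  proof (rule maximalidealI)
    show "ideal M R" and "carrier R \<noteq> M"
      using M(1) by (auto simp: A_def)
  next
    fix I assume I: "ideal I R" "M \<subseteq> I" "I \<subseteq> carrier R"
    show "I = M \<or> I = carrier R"
    proof (cases "\<one> \<in> I")
      case True
      then show ?thesis
        using ideal.one_imp_carrier[OF I(1)] by simp
    next
      case False
      then show ?thesis
        using M I by (auto simp: A_def)
    qed
  qed
  then show thesis
    using that M(1) by (auto simp: A_def)
qed

lemma (in cring) ideal_Units_imp_one:
  assumes "ideal I R" "u \<in> I" "u \<in> Units R"
  shows "\<one> \<in> I"
  using ideal.I_l_closed[OF assms(1,2), of "inv u"] assms(3) by simp

lemma (in cring) mem_cgenideal_iff_divides:
  assumes "b \<in> carrier R"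
  shows "a \<in> PIdl b \<longleftrightarrow> b divides a"
  using assms m_comm[of b] by (fastforce simp: cgenideal_def factor_def)

lemma (in cring) divides_add_left_iff:
  assumes "c divides a" and [simp]: "a \<in> carrier R" "b \<in> carrier R" "c \<in> carrier R"
  shows "c divides (a \<oplus> b) \<longleftrightarrow> c divides b"
proof
  obtain r where r [simp]: "r \<in> carrier R" and a: "a = c \<otimes> r"
    using assms(1) by (rule dividesE)
  show "c divides (a \<oplus> b)" if b: "c divides b"
  proof -
    obtain s where [simp]: "s \<in> carrier R" and b_eq: "b = c \<otimes> s"
      using b by (rule dividesE)
    have "a \<oplus> b = c \<otimes> (r \<oplus> s)"
      by (simp add: a b_eq r_distr)
    then show ?thesis by (rule dividesI[rotated]) simp
  qed
  show "c divides b" if ab: "c divides (a \<oplus> b)"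
  proof -
    obtain s where [simp]: "s \<in> carrier R" and s: "a \<oplus> b = c \<otimes> s"
      using ab by (rule dividesE)
    have "b = \<ominus> a \<oplus> (a \<oplus> b)"
      by (simp add: r_neg1)
    also have "\<dots> = c \<otimes> (\<ominus> r \<oplus> s)"
      unfolding s by (simp add: a r_distr r_minus)
    finally show ?thesis by (rule dividesI[rotated]) simp
  qed
qed

lemma (in cring) nonunits_mult:
  assumes "a \<in> nonunits R" "b \<in> carrier R"
  shows "a \<otimes> b \<in> nonunits R"
  using assms unit_factor[of a b] by (auto simp: nonunits_def)

text \<open>A non-unit generates a proper ideal, which lies in some maximal ideal and hence in the
  unique one. Conversely, a maximal ideal is proper and so contains no unit.\<close>

lemma (in cring) nonunits_ideal:
  assumes "local_ring R"
  shows "ideal (nonunits R) R"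
proof -
  obtain M where M: "maximalideal M R" and unique: "\<And>N. maximalideal N R \<Longrightarrow> N = M"
    using local_ring.unique_maximal[OF assms] by blast
  interpret M: maximalideal M R by (rule M)
  have "nonunits R = M"
  proof
    have "\<one> \<notin> M"
      using M.one_imp_carrier M.I_notcarr by blast
    then show "M \<subseteq> nonunits R"
      using ideal_Units_imp_one[OF M.is_ideal] M.Icarr unfolding nonunits_def by blast
  next
    show "nonunits R \<subseteq> M"
    proof
      fix a assume a: "a \<in> nonunits R"
      then have carr: "a \<in> carrier R" by (simp add: nonunits_def)
      have "\<one> \<notin> PIdl a"
        using nonunits_mult[OF a] Units_one_closed
        unfolding mem_cgenideal_iff_divides[OF carr] nonunits_def factor_def by force
      then obtain N where "maximalideal N R" "PIdl a \<subseteq> N"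
        using proper_ideal_subset_maximalideal[OF cgenideal_ideal[OF carr]] by blast
      then show "a \<in> M"
        using unique cgenideal_self[OF carr] by blast
    qed
  qed
  then show ?thesis
    using M.is_ideal by simp
qed

text \<open>Inclusion of principal ideals is divisibility reversed. From here on, adjacency is
  handled only through common non-unit divisors.\<close>

lemma (in cring) adjacent_upper_ideal_relation_graph_iff:
  "{x, y} \<in> edges (upper_ideal_relation_graph R) \<longleftrightarrow>
     x \<in> nonunits R \<and> y \<in> nonunits R \<and> x \<noteq> y \<and> (\<exists>z \<in> nonunits R. z divides x \<and> z divides y)"
proof -
  have dvd: "PIdl x \<subseteq> PIdl z \<longleftrightarrow> z divides x" if "x \<in> nonunits R" "z \<in> nonunits R" for x z
    using that to_contain_is_to_divide unfolding nonunits_def by blast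
  have *: "(\<exists>z \<in> nonunits R. PIdl x \<subseteq> PIdl z \<and> PIdl y \<subseteq> PIdl z) \<longleftrightarrow>
      (\<exists>z \<in> nonunits R. z divides x \<and> z divides y)"
    if "x \<in> nonunits R" "y \<in> nonunits R"
    using that by (intro bex_cong refl) (simp add: dvd)
  have "{x, y} \<in> edges (upper_ideal_relation_graph R) \<longleftrightarrow>
      x \<in> nonunits R \<and> y \<in> nonunits R \<and> x \<noteq> y \<and>
      (\<exists>z \<in> nonunits R. PIdl x \<subseteq> PIdl z \<and> PIdl y \<subseteq> PIdl z)"
    unfolding upper_ideal_relation_graph_def
    by (simp add: doubleton_eq_iff) blast
  then show ?thesis
    using * by blast
qed

section \<open>Artinian local rings: T-nilpotence and its consequences\<close>

locale artinian_local_cring = cring + artinian_ring + local_ring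
begin

sublocale nonunits: ideal "nonunits R" R
  by (rule nonunits_ideal) (rule local_ring_axioms)

text \<open>Otherwise the sum of \<open>\<one> \<ominus> a\<close> and \<open>a\<close>, which is
  the unit element, would lie in the ideal of non-units.\<close>

lemma one_minus_nonunit:
  assumes "a \<in> nonunits R"
  shows "\<one> \<ominus> a \<in> Units R"
proof (rule ccontr)
  have a: "a \<in> carrier R" using assms nonunits.Icarr by blast
  assume "\<one> \<ominus> a \<notin> Units R"
  then have "\<one> \<ominus> a \<in> nonunits R"
    using a by (simp add: nonunits_def)
  then have "(\<one> \<ominus> a) \<oplus> a \<in> nonunits R"
    using assms by (rule nonunits.a_closed)
  moreover have "(\<one> \<ominus> a) \<oplus> a = \<one>"
    using a by algebra
  ultimately show False
    by (simp add: nonunits_def)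
qed

text \<open>This is T-nilpotence. The descending chain of the ideals generated by the
  \<open>p n\<close> stabilises, so \<open>p n\<close> is a multiple
  \<open>r \<otimes> (a n \<otimes> p n)\<close> of its successor. Hence
  \<open>\<one> \<ominus> a n \<otimes> r\<close> annihilates \<open>p n\<close>, and this factor is
  a unit.\<close>

lemma nonunit_products_vanish:
  assumes a: "\<And>n :: nat. a n \<in> nonunits R"
    and p0: "p 0 \<in> carrier R" and pSuc: "\<And>n. p (Suc n) = a n \<otimes> p n"
  shows "\<exists>n. p n = \<zero>"
proof -
  have acarr: "a n \<in> carrier R" for n
    using a nonunits.Icarr by blast
  have p: "p n \<in> carrier R" for n
    by (induction n) (use p0 acarr in \<open>auto simp: pSuc\<close>)
  have "antimono (\<lambda>n. PIdl (p n))"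
    unfolding decseq_Suc_iff
  proof
    fix n
    have "p (Suc n) \<in> PIdl (p n)"
      unfolding pSuc using acarr by (rule ideal.I_l_closed[OF cgenideal_ideal cgenideal_self, OF p p])
    then show "PIdl (p (Suc n)) \<subseteq> PIdl (p n)"
      by (rule cgenideal_minimal[OF cgenideal_ideal[OF p]])
  qed
  then obtain n where n: "\<And>m. m \<ge> n \<Longrightarrow> PIdl (p m) = PIdl (p n)"
    using descending_chain[of "\<lambda>n. PIdl (p n)"] cgenideal_ideal[OF p] by blast
  have "p n \<in> PIdl (p (Suc n))"
    using n[of "Suc n"] cgenideal_self[OF p] by simp
  then obtain r where r: "r \<in> carrier R" "p n = r \<otimes> (a n \<otimes> p n)"
    unfolding cgenideal_def pSuc by blast
  have "(\<one> \<ominus> a n \<otimes> r) \<otimes> p n = p n \<ominus> r \<otimes> (a n \<otimes> p n)"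
    using r(1) p acarr by algebra
  also have "\<dots> = \<zero>"
    using r(2) p[of n] by (metis r_right_minus_eq)
  finally have "(\<one> \<ominus> a n \<otimes> r) \<otimes> p n = (\<one> \<ominus> a n \<otimes> r) \<otimes> \<zero>"
    using r(1) acarr by simp
  moreover have "\<one> \<ominus> a n \<otimes> r \<in> Units R"
    using one_minus_nonunit[OF nonunits_mult[OF a r(1)]] .
  ultimately have "p n = \<zero>"
    using Units_l_cancel p by blast
  then show ?thesis ..
qed

text \<open>In terms of ideals, \<open>z\<close> generates a maximal proper principal ideal
  containing \<open>x\<close>. Failure would give a strictly ascending chain of principal ideals,
  whose successive cofactors are non-units, and T-nilpotence applies to them.\<close>

lemma nonunit_minimal_divisor:
  assumes "x \<in> nonunits R"
  shows "\<exists>z \<in> nonunits R. z divides x \<and> (\<forall>w \<in> nonunits R. w divides z \<longrightarrow> z divides w)"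
proof (rule ccontr)
  assume "\<not> ?thesis"
  then obtain f where f: "\<And>z. z \<in> nonunits R \<Longrightarrow> z divides x \<Longrightarrow>
      f z \<in> nonunits R \<and> f z divides z \<and> \<not> z divides f z"
    by metis
  define z where "z n = (f ^^ n) x" for n
  have z_Suc: "z (Suc n) = f (z n)" for n
    by (simp add: z_def)
  have z: "z n \<in> nonunits R \<and> z n divides x" for n
  proof (induction n)
    case 0
    then show ?case using assms nonunits.Icarr by (simp add: z_def)
  next
    case (Suc n)
    then show ?case
      using f[of "z n"] assms nonunits.Icarr unfolding z_Suc by (meson divides_trans)
  qed
  have zcarr: "z n \<in> carrier R" for n
    using z nonunits.Icarr by blast
  have ndvd: "\<not> z n divides z (Suc n)" and "z (Suc n) divides z n" for n
    using f z unfolding z_Suc by blast+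
  then have "\<exists>a. a \<in> carrier R \<and> z n = a \<otimes> z (Suc n)" for n
    using zcarr by (metis dividesE m_comm)
  then obtain a where a: "\<And>n. a n \<in> carrier R" "\<And>n. z n = a n \<otimes> z (Suc n)"
    by metis
  have a_nonunit: "a n \<in> nonunits R" for n
  proof (rule ccontr)
    assume "a n \<notin> nonunits R"
    then have u: "a n \<in> Units R"
      using a(1) by (simp add: nonunits_def)
    have "z (Suc n) = (inv (a n) \<otimes> a n) \<otimes> z (Suc n)"
      using u zcarr by simp
    also have "\<dots> = z n \<otimes> inv (a n)"
      using u a zcarr m_assoc m_comm by (metis Units_inv_closed)
    finally have "z n divides z (Suc n)"
      using u by auto
    then show False
      using ndvd by blast
  qed
  \<comment> \<open>The product starts with \<open>a 1\<close>, not \<open>a 0\<close>: its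
    vanishing makes \<open>z 1\<close> zero and so a multiple of \<open>z 0\<close>, against
    strictness. Having only \<open>z 0\<close> zero would be no contradiction, as \<open>x\<close>
    may be zero.\<close>
  define p where "p = rec_nat \<one> (\<lambda>n q. a (Suc n) \<otimes> q)"
  have p: "p 0 = \<one>" "p (Suc n) = a (Suc n) \<otimes> p n" for n
    by (simp_all add: p_def)
  have pcarr: "p n \<in> carrier R" for n
    by (induction n) (use a in \<open>auto simp: p\<close>)
  have z1: "z 1 = p n \<otimes> z (Suc n)" for n
  proof (induction n)
    case 0
    then show ?case using zcarr by (simp add: p)
  next
    case (Suc n)
    have "p n \<otimes> (a (Suc n) \<otimes> z (Suc (Suc n))) = a (Suc n) \<otimes> p n \<otimes> z (Suc (Suc n))"
      using pcarr a(1) zcarr by algebra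
    then show ?case
      using Suc a(2)[of "Suc n"] by (simp add: p)
  qed
  obtain n where "p n = \<zero>"
    using nonunit_products_vanish[of "\<lambda>n. a (Suc n)" p] a_nonunit p by auto
  then have "z 1 = z 0 \<otimes> \<zero>"
    using z1[of n] zcarr by simp
  then show False
    using ndvd[of 0] by auto
qed

text \<open>Split off factors \<open>m\<close> from \<open>x\<close> until the cofactor is a unit. A
  cofactor that is not a unit lies in the ideal generated by \<open>m\<close>, so another factor can
  be extracted.\<close>

lemma eq_unit_times_power:
  assumes m: "m \<in> carrier R" "nonunits R = PIdl m" and x: "x \<in> carrier R" "x \<noteq> \<zero>"
  obtains u k where "u \<in> Units R" "x = u \<otimes> m [^] (k :: nat)"
proof -
  have m': "m \<in> nonunits R"
    using m cgenideal_self by simp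
  \<comment> \<open>T-nilpotence for a constant sequence is nilpotence of \<open>m\<close>. It ends
    the extraction below: at exponent \<open>n\<close> the second alternative would make
    \<open>x\<close> zero.\<close>
  obtain n where n: "m [^] (n :: nat) = \<zero>"
    using nonunit_products_vanish[of "\<lambda>_. m" "\<lambda>n. m [^] (n :: nat)"] m' m(1)
    by (auto simp: m_comm)
  have "(\<exists>u k. u \<in> Units R \<and> x = u \<otimes> m [^] (k :: nat)) \<or>
      (\<exists>r \<in> carrier R. x = r \<otimes> m [^] (j :: nat))" for j
  proof (induction j)
    case 0
    have "x = x \<otimes> m [^] (0 :: nat)"
      using x by simp
    then show ?case
      using x(1) by blast
  next
    case (Suc j)
    show ?case
    proof (cases "\<exists>u k. u \<in> Units R \<and> x = u \<otimes> m [^] (k :: nat)")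
      case False
      then obtain r where r: "r \<in> carrier R" "x = r \<otimes> m [^] j"
        using Suc by blast
      then have "r \<in> nonunits R"
        using False by (auto simp: nonunits_def)
      then obtain s where "s \<in> carrier R" "r = s \<otimes> m"
        unfolding m(2) by (auto simp: cgenideal_def)
      then have "s \<in> carrier R" "x = s \<otimes> m [^] Suc j"
        using r(2) m(1) by (simp_all add: m_ac)
      then show ?thesis by blast
    qed simp
  qed
  from this[of n] show thesis
    using that x n by auto
qed

lemma principal_ideal_ring_if_nonunits:
  assumes m: "m \<in> carrier R" "nonunits R = PIdl m"
  shows "principal_ideal_ring R"
proof (intro principal_ideal_ring.intro principal_ideal_ring_axioms.intro)
  show "ring R" by (rule ring_axioms)
next
  fix I assume I: "ideal I R"
  interpret I: ideal I R by (rule I)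
  show "principalideal I R"
  proof (cases "I = {\<zero>}")
    case True
    then show ?thesis by (simp add: zeropideal)
  next
    case False
    \<comment> \<open>Stripping the unit shows that the exponent of each nonzero element of
      \<open>I\<close> is at least the smallest \<open>k\<close> with \<open>m [^] k\<close> in
      \<open>I\<close>, so this power generates \<open>I\<close>.\<close>
    have power_mem: "m [^] k \<in> I" if "u \<in> Units R" "u \<otimes> m [^] k \<in> I" for u and k :: nat
      using I.I_l_closed[OF that(2), of "inv u"] that(1) m(1)
      by (simp add: m_assoc[symmetric] Units_closed)
    obtain x where x: "x \<in> I" "x \<noteq> \<zero>"
      using False I.zero_closed by blast
    then have "\<exists>k :: nat. m [^] k \<in> I"
      using eq_unit_times_power[OF m] I.Icarr power_mem by metis
    define k :: nat where "k = (LEAST k. m [^] k \<in> I)"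
    have k: "m [^] k \<in> I"
      unfolding k_def using \<open>\<exists>k. _\<close> by (rule LeastI_ex)
    have "I = PIdl (m [^] k)"
    proof
      show "PIdl (m [^] k) \<subseteq> I"
        using I k by (rule cgenideal_minimal)
    next
      show "I \<subseteq> PIdl (m [^] k)"
      proof
        fix y assume y: "y \<in> I"
        show "y \<in> PIdl (m [^] k)"
        proof (cases "y = \<zero>")
          case True
          then show ?thesis
            using m(1) additive_subgroup.zero_closed cgenideal_ideal ideal.axioms(1) nat_pow_closed
            by blast
        next
          case False
          then obtain u j where u: "u \<in> Units R" and y_eq: "y = u \<otimes> m [^] (j :: nat)"
            using eq_unit_times_power[OF m I.Icarr[OF y]] by blast
          then have "k \<le> j"
            unfolding k_def using power_mem y by (blast intro: Least_le)
          then have "m [^] j = m [^] (j - k) \<otimes> m [^] k"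
            using m(1) by (simp add: nat_pow_mult)
          then have "y = (u \<otimes> m [^] (j - k)) \<otimes> m [^] k"
            using u m(1) y_eq by (simp add: m_assoc Units_closed)
          then show ?thesis
            using u m(1) by (auto simp: cgenideal_def)
        qed
      qed
    qed
    then show ?thesis
      using cgenideal_is_principalideal m(1) by simp
  qed
qed

section \<open>The two implications\<close>

lemma principal_ideal_ring_imp_is_line_graph:
  assumes "principal_ideal_ring R"
  shows "is_line_graph (upper_ideal_relation_graph R)"
proof (rule complete_graph_is_line_graph[OF simple_upper_ideal_relation_graph])
  obtain m where m: "m \<in> carrier R" "nonunits R = PIdl m"
    using principal_ideal_ring.principal[OF assms nonunits.is_ideal]
    by (metis principalideal.generate cgenideal_eq_genideal)
  fix x y assume xy: "x \<in> verts (upper_ideal_relation_graph R)"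
    "y \<in> verts (upper_ideal_relation_graph R)" "x \<noteq> y"
  then have xy': "x \<in> nonunits R" "y \<in> nonunits R"
    by (auto simp: upper_ideal_relation_graph_def)
  \<comment> \<open>The generator \<open>m\<close> is a common non-unit divisor for every pair of
    vertices.\<close>
  have "m \<in> nonunits R"
    using m cgenideal_self by simp
  moreover have "m divides v" if "v \<in> nonunits R" for v
    using that mem_cgenideal_iff_divides[OF m(1)] unfolding m(2) by blast
  ultimately have "\<exists>z \<in> nonunits R. z divides x \<and> z divides y"
    using xy' by metis
  then show "{x, y} \<in> edges (upper_ideal_relation_graph R)"
    using xy(3) xy' by (simp add: adjacent_upper_ideal_relation_graph_iff)
qed

lemma is_line_graph_imp_principal_ideal_ring:
  assumes "is_line_graph (upper_ideal_relation_graph R)"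
  shows "principal_ideal_ring R"
proof (rule ccontr)
  assume nonprincipal: "\<not> principal_ideal_ring R"
  \<comment> \<open>Every element divides zero, so applying the lemma to zero just yields some
    maximal proper principal ideal.\<close>
  obtain x where x: "x \<in> nonunits R"
    and x_max: "\<forall>w \<in> nonunits R. w divides x \<longrightarrow> x divides w"
    using nonunit_minimal_divisor[OF nonunits.zero_closed] by metis
  have xc: "x \<in> carrier R"
    using x nonunits.Icarr by blast
  have "nonunits R \<noteq> PIdl x"
    using principal_ideal_ring_if_nonunits nonprincipal xc by blast
  moreover have "PIdl x \<subseteq> nonunits R"
    using nonunits.is_ideal x by (rule cgenideal_minimal)
  ultimately obtain t where t: "t \<in> nonunits R" "t \<notin> PIdl x"
    by blast
  have xt: "\<not> x divides t"
    using t(2) by (simp add: mem_cgenideal_iff_divides[OF xc])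
  obtain y where y: "y \<in> nonunits R" and yt: "y divides t"
    and y_max: "\<forall>w \<in> nonunits R. w divides y \<longrightarrow> y divides w"
    using nonunit_minimal_divisor[OF t(1)] by metis
  have yc: "y \<in> carrier R"
    using y nonunits.Icarr by blast
  have xy: "\<not> x divides y"
    using xt divides_trans[OF _ yt xc] by metis
  \<comment> \<open>By maximality of \<open>x\<close>, a divisor \<open>y\<close> of
    \<open>x\<close> would be divisible by \<open>x\<close>, contrary to \<open>xy\<close>.\<close>
  have yx: "\<not> y divides x"
    using xy x_max y by metis
  \<comment> \<open>By maximality, a non-unit divisor \<open>z\<close> of \<open>x\<close> is also a
    multiple of \<open>x\<close>. Thus every neighbour of \<open>x\<close> is a multiple of
    \<open>x\<close>, which rules out \<open>y\<close> and \<open>x \<oplus> y\<close>;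
    \<open>common'\<close> does the same for \<open>y\<close>.\<close>
  have common: "x divides v" if "z \<in> nonunits R" "z divides x" "z divides v" for z v
    using divides_trans[OF _ that(3) xc] x_max that(1,2) by metis
  have common': "y divides v" if "z \<in> nonunits R" "z divides y" "z divides v" for z v
    using divides_trans[OF _ that(3) yc] y_max that(1,2) by metis
  have s: "x \<oplus> y \<in> nonunits R"
    using x y by (rule nonunits.a_closed)
  have x_sum: "\<not> x divides (x \<oplus> y)"
    using divides_add_left_iff[of x x y] xy xc yc by simp
  have y_sum: "\<not> y divides (x \<oplus> y)"
    using divides_add_left_iff[of y y x] yx xc yc by (simp add: a_comm)
  have divides_zero: "v divides \<zero>" if "v \<in> carrier R" for v
    using that by (metis dividesI r_null zero_closed)
  have refl: "v divides v" if "v \<in> nonunits R" for v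
    using that nonunits.Icarr by simp
  let ?E = "edges (upper_ideal_relation_graph R)"
  \<comment> \<open>Here \<open>v\<close> itself is the common divisor.\<close>
  have zero_adj: "{\<zero>, v} \<in> ?E" if "v \<in> nonunits R" "v \<noteq> \<zero>" for v
    using that refl divides_zero[OF nonunits.Icarr] nonunits.zero_closed
    unfolding adjacent_upper_ideal_relation_graph_iff by metis
  have "x \<noteq> \<zero>" "y \<noteq> \<zero>" "x \<oplus> y \<noteq> \<zero>"
    using xy yx x_sum divides_zero[OF xc] divides_zero[OF yc] by metis+
  then have "{\<zero>, x} \<in> ?E" "{\<zero>, y} \<in> ?E" "{\<zero>, x \<oplus> y} \<in> ?E"
    using zero_adj x y s by simp_all
  moreover have "x \<noteq> y" "x \<noteq> x \<oplus> y" "y \<noteq> x \<oplus> y"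
    using xy x_sum y_sum refl[OF x] refl[OF y] by metis+
  moreover have "{x, y} \<notin> ?E" "{x, x \<oplus> y} \<notin> ?E" "{y, x \<oplus> y} \<notin> ?E"
    using xy x_sum y_sum common common' unfolding adjacent_upper_ideal_relation_graph_iff by metis+
  ultimately show False
    using is_line_graph_claw_free[OF assms simple_upper_ideal_relation_graph] by metis
qed

end

theorem theorem2p3:
  fixes R :: "('a, 'b) ring_scheme" (structure)
  assumes "cring R" and "artinian_ring R" and "local_ring R"
  shows "is_line_graph (upper_ideal_relation_graph R) \<longleftrightarrow> principal_ideal_ring R"
proof -
  interpret artinian_local_cring R
    using assms by (rule artinian_local_cring.intro)
  show ?thesis
    using is_line_graph_imp_principal_ideal_ring principal_ideal_ring_imp_is_line_graph by blast
qed

end
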